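(* Let $R$ be a commutative ring with $1\neq 0$ and let $S$ be a multiplicatively closed subset of $R$. Then $\mathrm{Spec}_SR$ is connected with respect to the $S$-flat topology if and only if it is connected with respect to the $S$-Zariski topology.
   Context: A multiplicatively closed subset $S$ of $R$ satisfies $0\notin S$, $1\in S$, and $ss'\in S$ for all $s,s'\in S$. An ideal $P$ of $R$ is $S$-prime if $P\cap S=\emptyset$ and there exists $s\in S$ such that for all $a,b\in R$, $ab\in P$ implies $sa\in P$ or $sb\in P$. $\mathrm{Spec}_SR$ is the set of all $S$-prime ideals of $R$. For $E\subseteq R$, $V_S(E)=\{P\in\mathrm{Spec}_SR : sE\subseteq P \text{ for some } s\in S\}$; write $V_S(f)=V_S(\{f\})$. The $S$-Zariski topology on $\mathrm{Spec}_SR$ is the topology whose closed sets are the sets $V_S(I)$, $I$ an ideal of $R$. The $S$-flat topology on $\mathrm{Spec}_SR$ is the topology having the sets $V_S(f)$, $f\in R$, as a sub-basis of open sets. *)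

theory Defs
  imports "HOL-Algebra.Ideal" "HOL-Analysis.Abstract_Topology"
begin

definition mult_closed :: "('a, 'b) ring_scheme \<Rightarrow> 'a set \<Rightarrow> bool" where
  "mult_closed R S \<longleftrightarrow> submonoid S R \<and> \<zero>\<^bsub>R\<^esub> \<notin> S"

definition S_prime :: "('a, 'b) ring_scheme \<Rightarrow> 'a set \<Rightarrow> 'a set \<Rightarrow> bool" where
  "S_prime R S P \<longleftrightarrow> ideal P R \<and> P \<inter> S = {} \<and>
     (\<exists>s\<in>S. \<forall>a\<in>carrier R. \<forall>b\<in>carrier R.
        a \<otimes>\<^bsub>R\<^esub> b \<in> P \<longrightarrow> s \<otimes>\<^bsub>R\<^esub> a \<in> P \<or> s \<otimes>\<^bsub>R\<^esub> b \<in> P)"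

definition Spec_S :: "('a, 'b) ring_scheme \<Rightarrow> 'a set \<Rightarrow> 'a set set" where
  "Spec_S R S = {P. S_prime R S P}"

definition V_S :: "('a, 'b) ring_scheme \<Rightarrow> 'a set \<Rightarrow> 'a set \<Rightarrow> 'a set set" where
  "V_S R S E = {P \<in> Spec_S R S. \<exists>s\<in>S. (\<lambda>e. s \<otimes>\<^bsub>R\<^esub> e) ` E \<subseteq> P}"

definition S_zariski :: "('a, 'b) ring_scheme \<Rightarrow> 'a set \<Rightarrow> 'a set topology" where
  "S_zariski R S = topology (\<lambda>U. \<exists>I. ideal I R \<and> U = Spec_S R S - V_S R S I)"

text \<open>The sub-basis covers the whole spectrum, because \<open>V_S R S {\<zero>\<^bsub>R\<^esub>} = Spec_S R S\<close>;
  see \<open>topspace_S_flat\<close>.\<close>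

definition S_flat :: "('a, 'b) ring_scheme \<Rightarrow> 'a set \<Rightarrow> 'a set topology" where
  "S_flat R S = topology_generated_by {V_S R S {f} | f. f \<in> carrier R}"

text \<open>\<open>topology\<close> is only meaningful on predicates satisfying \<open>istopology\<close>. The following shows that
  this is the case in \<open>S_zariski\<close>, and that both topologies live on \<open>Spec_S R S\<close>. The key point is
  that a single \<open>t \<in> S\<close>, depending on \<open>P\<close> only, witnesses all memberships \<open>P \<in> V_S R S E\<close>.\<close>

context cring
begin

lemma V_S_witness:
  assumes S: "mult_closed R S" and P: "P \<in> Spec_S R S"
  obtains t where "t \<in> S"
    and "\<And>a b. a \<in> carrier R \<Longrightarrow> b \<in> carrier R \<Longrightarrow> a \<otimes> b \<in> P \<Longrightarrow> t \<otimes> a \<in> P \<or> t \<otimes> b \<in> P"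
    and "\<And>E. E \<subseteq> carrier R \<Longrightarrow> P \<in> V_S R S E \<longleftrightarrow> (\<forall>e\<in>E. t \<otimes> e \<in> P)"
proof -
  have sub: "S \<subseteq> carrier R" and cl: "\<And>x y. x \<in> S \<Longrightarrow> y \<in> S \<Longrightarrow> x \<otimes> y \<in> S"
    using S by (auto simp: mult_closed_def submonoid_def)
  have disj: "P \<inter> S = {}"
    using P by (simp add: Spec_S_def S_prime_def)
  obtain t where t: "t \<in> S"
    and pr: "\<And>a b. a \<in> carrier R \<Longrightarrow> b \<in> carrier R \<Longrightarrow> a \<otimes> b \<in> P \<Longrightarrow> t \<otimes> a \<in> P \<or> t \<otimes> b \<in> P"
    using P by (auto simp: Spec_S_def S_prime_def)
  have "P \<in> V_S R S E \<longleftrightarrow> (\<forall>e\<in>E. t \<otimes> e \<in> P)" if E: "E \<subseteq> carrier R" for E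
  proof
    assume "P \<in> V_S R S E"
    then obtain s where s: "s \<in> S" "\<And>e. e \<in> E \<Longrightarrow> s \<otimes> e \<in> P"
      by (auto simp: V_S_def)
    have "t \<otimes> s \<notin> P" using cl[OF t s(1)] disj by blast
    then show "\<forall>e\<in>E. t \<otimes> e \<in> P"
      using pr s sub E by blast
  next
    assume "\<forall>e\<in>E. t \<otimes> e \<in> P"
    then show "P \<in> V_S R S E" using t P by (auto simp: V_S_def)
  qed
  then show ?thesis using that t pr by blast
qed

lemma V_S_inter:
  assumes S: "mult_closed R S" and I: "ideal I R" and J: "ideal J R"
  shows "V_S R S (I \<inter> J) = V_S R S I \<union> V_S R S J"
proof -
  have Ic: "I \<subseteq> carrier R" and Jc: "J \<subseteq> carrier R"
    using I J by (auto dest: ideal.Icarr)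
  have "P \<in> V_S R S (I \<inter> J) \<longleftrightarrow> P \<in> V_S R S I \<or> P \<in> V_S R S J" if P: "P \<in> Spec_S R S" for P
  proof -
    obtain t where t: "t \<in> S"
      and pr: "\<And>a b. a \<in> carrier R \<Longrightarrow> b \<in> carrier R \<Longrightarrow> a \<otimes> b \<in> P \<Longrightarrow> t \<otimes> a \<in> P \<or> t \<otimes> b \<in> P"
      and w: "\<And>E. E \<subseteq> carrier R \<Longrightarrow> P \<in> V_S R S E \<longleftrightarrow> (\<forall>e\<in>E. t \<otimes> e \<in> P)"
      using V_S_witness[OF S P] by blast
    have tc: "t \<in> carrier R" using t S by (auto simp: mult_closed_def submonoid_def)
    have tt: "t \<otimes> (t \<otimes> t) \<in> S" using t S by (auto simp: mult_closed_def submonoid_def)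
    moreover have "P \<inter> S = {}" using P by (auto simp: Spec_S_def S_prime_def)
    ultimately have ttP: "t \<otimes> (t \<otimes> t) \<notin> P" by blast
    have div: "t \<otimes> a \<in> P" if a: "a \<in> carrier R" and h: "t \<otimes> (t \<otimes> a) \<in> P" for a
    proof -
      have "(t \<otimes> t) \<otimes> a \<in> P" using h a tc by (simp add: m_assoc)
      then show ?thesis using pr[OF _ a, of "t \<otimes> t"] tc ttP by auto
    qed
    have "(\<forall>e\<in>I. t \<otimes> e \<in> P) \<or> (\<forall>e\<in>J. t \<otimes> e \<in> P)" if h: "\<forall>e\<in>I \<inter> J. t \<otimes> e \<in> P"
    proof (rule ccontr)
      assume "\<not> ?thesis"
      then obtain a b where a: "a \<in> I" "t \<otimes> a \<notin> P" and b: "b \<in> J" "t \<otimes> b \<notin> P" by blast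
      have ac: "a \<in> carrier R" and bc: "b \<in> carrier R" using a b Ic Jc by auto
      have "a \<otimes> b \<in> I \<inter> J"
        using ideal.I_r_closed[OF I a(1) bc] ideal.I_l_closed[OF J b(1) ac] by simp
      then have "(t \<otimes> a) \<otimes> b \<in> P" using h ac bc tc by (simp add: m_assoc)
      then have "t \<otimes> (t \<otimes> a) \<in> P \<or> t \<otimes> b \<in> P" using pr ac bc tc by simp
      then show False using div[OF ac] a b by blast
    qed
    then show ?thesis using w[of I] w[of J] w[of "I \<inter> J"] Ic Jc by blast
  qed
  then show ?thesis unfolding V_S_def by blast
qed

lemma V_S_genideal:
  assumes S: "mult_closed R S" and E: "E \<subseteq> carrier R"
  shows "V_S R S (Idl E) = V_S R S E"
proof
  show "V_S R S (Idl E) \<subseteq> V_S R S E"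
    using genideal_self[OF E] unfolding V_S_def by blast
  show "V_S R S E \<subseteq> V_S R S (Idl E)"
  proof
    fix P assume "P \<in> V_S R S E"
    then obtain s where P: "P \<in> Spec_S R S" and s: "s \<in> S" and sE: "\<And>e. e \<in> E \<Longrightarrow> s \<otimes> e \<in> P"
      unfolding V_S_def by blast
    have sc: "s \<in> carrier R" using s S by (auto simp: mult_closed_def submonoid_def)
    interpret P: ideal P R using P by (simp add: Spec_S_def S_prime_def)
    let ?K = "{x \<in> carrier R. s \<otimes> x \<in> P}"
    have "ideal ?K R"
    proof (rule idealI)
      show "ring R" by (rule ring_axioms)
      show "subgroup ?K (add_monoid R)"
      proof (rule add.subgroupI)
        show "?K \<noteq> {}" using sc by (auto intro!: exI[of _ \<zero>])
      next
        fix a assume "a \<in> ?K"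
        then show "\<ominus> a \<in> ?K" using sc by (auto simp: r_minus)
      next
        fix a b assume "a \<in> ?K" "b \<in> ?K"
        then show "a \<oplus> b \<in> ?K" using sc by (auto simp: r_distr)
      qed auto
      show "x \<otimes> a \<in> ?K" if "a \<in> ?K" "x \<in> carrier R" for a x
        using that sc P.I_l_closed[of "s \<otimes> a" x] by (simp add: m_lcomm)
      show "a \<otimes> x \<in> ?K" if "a \<in> ?K" "x \<in> carrier R" for a x
        using that sc P.I_r_closed[of "s \<otimes> a" x] by (simp add: m_assoc)
    qed
    moreover have "E \<subseteq> ?K" using E sE by blast
    ultimately have "Idl E \<subseteq> ?K" by (rule genideal_minimal)
    then show "P \<in> V_S R S (Idl E)" using P s unfolding V_S_def by blast
  qed
qed

lemma V_S_Union:
  assumes S: "mult_closed R S" and K: "\<And>E. E \<in> K \<Longrightarrow> E \<subseteq> carrier R"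
  shows "V_S R S (\<Union>K) = {P \<in> Spec_S R S. \<forall>E\<in>K. P \<in> V_S R S E}"
proof -
  have "P \<in> V_S R S (\<Union>K) \<longleftrightarrow> (\<forall>E\<in>K. P \<in> V_S R S E)" if P: "P \<in> Spec_S R S" for P
  proof -
    obtain t where w: "\<And>E. E \<subseteq> carrier R \<Longrightarrow> P \<in> V_S R S E \<longleftrightarrow> (\<forall>e\<in>E. t \<otimes> e \<in> P)"
      by (rule V_S_witness[OF S P]) (rule that)
    have "\<Union>K \<subseteq> carrier R" using K by blast
    then show ?thesis by (auto simp: w w[OF K])
  qed
  then show ?thesis unfolding V_S_def by blast
qed

lemma V_S_zero:
  assumes S: "mult_closed R S"
  shows "V_S R S {\<zero>} = Spec_S R S"
proof -
  have "\<one> \<in> S" using S by (simp add: mult_closed_def submonoid_def)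
  moreover have "\<one> \<otimes> \<zero> = \<zero>" by simp
  moreover have "\<zero> \<in> P" if "P \<in> Spec_S R S" for P
    using that by (simp add: Spec_S_def S_prime_def ideal_def additive_subgroup.zero_closed)
  ultimately show ?thesis unfolding V_S_def by force
qed

lemma V_S_carrier:
  assumes S: "mult_closed R S"
  shows "V_S R S (carrier R) = {}"
proof -
  have "s \<in> (\<lambda>e. s \<otimes> e) ` carrier R" if "s \<in> S" for s
    using that S by (intro image_eqI[of _ _ \<one>]) (auto simp: mult_closed_def submonoid_def)
  then show ?thesis unfolding V_S_def Spec_S_def S_prime_def by blast
qed

lemma istopology_S_zariski:
  assumes S: "mult_closed R S"
  shows "istopology (\<lambda>U. \<exists>I. ideal I R \<and> U = Spec_S R S - V_S R S I)"
  unfolding istopology_def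
proof (intro conjI allI impI)
  fix U V
  assume "\<exists>I. ideal I R \<and> U = Spec_S R S - V_S R S I" "\<exists>I. ideal I R \<and> V = Spec_S R S - V_S R S I"
  then obtain I J where "ideal I R" "U = Spec_S R S - V_S R S I"
    and "ideal J R" "V = Spec_S R S - V_S R S J" by blast
  then show "\<exists>I. ideal I R \<and> U \<inter> V = Spec_S R S - V_S R S I"
    by (intro exI[of _ "I \<inter> J"]) (auto simp: V_S_inter[OF S] i_intersect)
next
  fix \<K> assume \<K>: "\<forall>U\<in>\<K>. \<exists>I. ideal I R \<and> U = Spec_S R S - V_S R S I"
  define K where "K = {I. ideal I R \<and> Spec_S R S - V_S R S I \<in> \<K>}"
  have Kc: "\<And>E. E \<in> K \<Longrightarrow> E \<subseteq> carrier R"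
    by (auto simp: K_def dest: ideal.Icarr)
  have eq: "\<K> = (\<lambda>I. Spec_S R S - V_S R S I) ` K"
  proof
    show "\<K> \<subseteq> (\<lambda>I. Spec_S R S - V_S R S I) ` K"
      using \<K> unfolding K_def by fastforce
  qed (auto simp: K_def)
  have "\<Union>\<K> = Spec_S R S - V_S R S (\<Union>K)"
    unfolding eq by (auto simp: V_S_Union[OF S Kc])
  moreover have "\<Union>K \<subseteq> carrier R" using Kc by blast
  ultimately show "\<exists>I. ideal I R \<and> \<Union>\<K> = Spec_S R S - V_S R S I"
    using V_S_genideal[OF S] genideal_ideal by metis
qed

lemma openin_S_zariski:
  "mult_closed R S \<Longrightarrow>
     openin (S_zariski R S) U \<longleftrightarrow> (\<exists>I. ideal I R \<and> U = Spec_S R S - V_S R S I)"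
  by (simp add: S_zariski_def istopology_S_zariski topology_inverse')

lemma topspace_S_zariski:
  assumes S: "mult_closed R S"
  shows "topspace (S_zariski R S) = Spec_S R S"
proof
  show "topspace (S_zariski R S) \<subseteq> Spec_S R S"
    by (auto simp: topspace_def openin_S_zariski[OF S])
  have "openin (S_zariski R S) (Spec_S R S)"
    unfolding openin_S_zariski[OF S]
    by (rule exI[of _ "carrier R"]) (simp add: V_S_carrier[OF S] oneideal)
  then show "Spec_S R S \<subseteq> topspace (S_zariski R S)"
    by (rule openin_subset)
qed

lemma closedin_S_zariski:
  assumes S: "mult_closed R S"
  shows "closedin (S_zariski R S) C \<longleftrightarrow> (\<exists>I. ideal I R \<and> C = V_S R S I)"
proof -
  have "V_S R S I \<subseteq> Spec_S R S" for I by (auto simp: V_S_def)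
  then show ?thesis
    unfolding closedin_def topspace_S_zariski[OF S] openin_S_zariski[OF S] by blast
qed

lemma topspace_S_flat:
  assumes S: "mult_closed R S"
  shows "topspace (S_flat R S) = Spec_S R S"
proof -
  have "Spec_S R S \<in> {V_S R S {f} | f. f \<in> carrier R}"
    using V_S_zero[OF S] zero_closed by (intro CollectI exI[of _ \<zero>]) simp
  moreover have "V_S R S {f} \<subseteq> Spec_S R S" for f by (auto simp: V_S_def)
  ultimately show ?thesis
    unfolding S_flat_def topology_generated_by_topspace by (intro equalityI) auto
qed

end

end

theory Submission
  imports Defs "HOL-Algebra.Ring_Divisibility" "HOL-Analysis.Function_Topology"
begin

text \<open>The two topologies have the same clopen sets, so one is connected exactly when the other is.

  Write \<open>V(E)\<close> for \<open>V_S R S E\<close>. Every prime ideal disjoint from \<open>S\<close> is \<open>S\<close>-prime, so the spectrum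
  has enough points for Krull's separation lemma (\<open>exists_primeideal_disjoint\<close>) to turn statements
  about the sets \<open>V(E)\<close> into algebra.

  If \<open>V(I)\<close> and \<open>V(J)\<close> are complementary, then no point contains \<open>I\<close> and \<open>J\<close> up to a factor in \<open>S\<close>,
  so some \<open>a \<oplus> b\<close> with \<open>a \<in> I\<close> and \<open>b \<in> J\<close> lies in \<open>S\<close>, and \<open>V(a \<oplus> b)\<close> is empty. Then \<open>V(a)\<close>
  and \<open>V(b)\<close> are disjoint and contain \<open>V(I)\<close> and \<open>V(J)\<close>, which already fill the spectrum; hence
  \<open>V(I) = V(a)\<close>, and a Zariski clopen set is flat open.

  Conversely, the flat topology is compact (\<open>compact_space_S_flat\<close>), so a flat clopen set is compact
  and is therefore a finite union of finite intersections of sets \<open>V(f)\<close>. Each \<open>V(f)\<close> is Zariski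
  closed, hence so is every flat clopen set. Complements give the rest.\<close>

section \<open>Compactness and sub-bases\<close>

text \<open>The theorem \<open>Alexander_subbase\<close> builds the topology from finite intersections relative to the
  union of the sub-basis. The only intersection that \<open>topology_generated_by\<close> does not form is the
  empty one, which is that union and therefore open all the same.\<close>

lemma compact_space_topology_generated_by:
  assumes fin: "\<And>\<C>. \<lbrakk>\<C> \<subseteq> \<B>; \<Union>\<C> = \<Union>\<B>\<rbrakk> \<Longrightarrow> \<exists>\<C>'. finite \<C>' \<and> \<C>' \<subseteq> \<C> \<and> \<Union>\<C>' = \<Union>\<B>"
  shows "compact_space (topology_generated_by \<B>)"
proof -
  let ?X = "topology (arbitrary union_of (finite intersection_of (\<lambda>x. x \<in> \<B>) relative_to \<Union>\<B>))"
  have sub: "openin ?X B" if "B \<in> \<B>" for B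
  proof -
    have "(finite intersection_of (\<lambda>x. x \<in> \<B>) relative_to \<Union>\<B>) B"
      using that by (intro relative_to_subset_inc finite_intersection_of_inc) auto
    then show ?thesis
      unfolding openin_subbase by (rule arbitrary_union_of_inc)
  qed
  have "openin ?X U \<longleftrightarrow> openin (topology_generated_by \<B>) U" for U
  proof
    assume "openin ?X U"
    then show "openin (topology_generated_by \<B>) U"
    proof (rule minimal_topology_subbase[rotated 2])
      show "openin (topology_generated_by \<B>) (\<Union>\<B>)"
        using openin_topspace[of "topology_generated_by \<B>"] by simp
    qed (rule topology_generated_by_Basis)
  next
    assume "openin (topology_generated_by \<B>) U"
    then show "openin ?X U"
      unfolding openin_topology_generated_by_iff
      using generate_topology_on_coarsest[OF istopology_openin sub] by blast
  qed
  then have "?X = topology_generated_by \<B>"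
    by (simp add: topology_eq)
  then show ?thesis
    by (rule Alexander_subbase) (use fin in simp)
qed

text \<open>Being closed in \<open>Y\<close> passes from the sub-basis to its finite intersections, which form a basis,
  and a compact open set is a union of finitely many basic open sets.\<close>

lemma compact_open_imp_closedin:
  assumes \<B>: "\<And>B. B \<in> \<B> \<Longrightarrow> closedin Y B"
    and U: "openin (topology_generated_by \<B>) U" "compactin (topology_generated_by \<B>) U"
  shows "closedin Y U"
proof -
  let ?X = "topology_generated_by \<B>"
  define \<N> where "\<N> = {N. openin ?X N \<and> closedin Y N \<and> N \<subseteq> U}"
  have "generate_topology_on \<B> U"
    using U(1) by (simp add: openin_topology_generated_by_iff)
  then have nbhd: "\<forall>x\<in>U. \<exists>N. x \<in> N \<and> openin ?X N \<and> closedin Y N \<and> N \<subseteq> U"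
  proof induction
    case Empty
    then show ?case by simp
  next
    case (Int a b)
    show ?case
    proof
      fix x assume "x \<in> a \<inter> b"
      with Int.IH obtain M N where
        "x \<in> M" "openin ?X M" "closedin Y M" "M \<subseteq> a" "x \<in> N" "openin ?X N" "closedin Y N" "N \<subseteq> b"
        by blast
      then show "\<exists>N. x \<in> N \<and> openin ?X N \<and> closedin Y N \<and> N \<subseteq> a \<inter> b"
        by (intro exI[of _ "M \<inter> N"]) auto
    qed
  next
    case (UN K)
    then show ?case by (meson UnionE Union_upper subset_trans)
  next
    case (Basis B)
    then show ?case
      using \<B> by (auto intro: topology_generated_by_Basis)
  qed
  have "U \<subseteq> \<Union>\<N>"
    using nbhd unfolding \<N>_def by blast
  moreover have "\<forall>N\<in>\<N>. openin ?X N"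
    by (simp add: \<N>_def)
  ultimately obtain \<F> where \<F>: "finite \<F>" "\<F> \<subseteq> \<N>" "U \<subseteq> \<Union>\<F>"
    using U(2) unfolding compactin_def by meson
  then have "U = \<Union>\<F>"
    unfolding \<N>_def by blast
  then show ?thesis
    using \<F> closedin_Union[of \<F> Y] by (auto simp: \<N>_def)
qed

section \<open>Prime ideals disjoint from a multiplicative set\<close>

context cring
begin

text \<open>Krull's separation lemma: an ideal maximal among those that contain \<open>I\<close> and avoid \<open>M\<close> is
  prime. If \<open>a\<close> and \<open>b\<close> were outside of it, adjoining either would reach \<open>M\<close>, and the product of
  the two elements reached would be in \<open>M\<close> and, when \<open>a \<otimes> b\<close> is inside, in the ideal too.\<close>

lemma exists_primeideal_disjoint:
  assumes I: "ideal I R" and M: "submonoid M R" and disj: "I \<inter> M = {}"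
  obtains P where "primeideal P R" "I \<subseteq> P" "P \<inter> M = {}"
proof -
  define \<A> where "\<A> = {J. ideal J R \<and> I \<subseteq> J \<and> J \<inter> M = {}}"
  have "\<exists>P\<in>\<A>. \<forall>J\<in>\<A>. P \<subseteq> J \<longrightarrow> J = P"
  proof (rule subset_Zorn_nonempty)
    show "\<A> \<noteq> {}" using I disj by (auto simp: \<A>_def)
  next
    fix \<C> assume ne: "\<C> \<noteq> {}" and ch: "subset.chain \<A> \<C>"
    then have "subset.chain {J. ideal J R} \<C>"
      by (auto simp: pred_on.chain_def \<A>_def)
    then have "ideal (\<Union>\<C>) R"
      using chain_Union_is_ideal[of \<C>] ne by simp
    moreover have "\<C> \<subseteq> \<A>"
      using ch by (simp add: pred_on.chain_def)
    ultimately show "\<Union>\<C> \<in> \<A>"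
      using ne unfolding \<A>_def by blast
  qed
  then obtain P where P: "ideal P R" and IP: "I \<subseteq> P" and PM: "P \<inter> M = {}"
    and max: "\<And>J. J \<in> \<A> \<Longrightarrow> P \<subseteq> J \<Longrightarrow> J = P"
    by (auto simp: \<A>_def)
  interpret P: ideal P R by (rule P)
  interpret M: submonoid M R by (rule M)
  have reach: "\<exists>p\<in>P. \<exists>r\<in>carrier R. p \<oplus> r \<otimes> a \<in> M" if a: "a \<in> carrier R" "a \<notin> P" for a
  proof -
    let ?J = "P <+>\<^bsub>R\<^esub> PIdl a"
    have J: "ideal ?J R"
      by (intro add_ideals P cgenideal_ideal a)
    have eq: "?J = Idl (P \<union> PIdl a)"
      using union_genideal[OF P cgenideal_ideal[OF a(1)]] by simp
    have "P \<union> PIdl a \<subseteq> carrier R"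
      using P.Icarr ideal.Icarr[OF cgenideal_ideal[OF a(1)]] by blast
    then have sub: "P \<union> PIdl a \<subseteq> ?J"
      unfolding eq by (rule genideal_self)
    then have "?J \<noteq> P"
      using cgenideal_self[OF a(1)] a(2) by blast
    then have "?J \<notin> \<A>"
      using max sub by blast
    then have "?J \<inter> M \<noteq> {}"
      using J sub IP by (auto simp: \<A>_def)
    then show ?thesis
      by (auto simp: set_add_def' cgenideal_def)
  qed
  have "primeideal P R"
  proof (rule primeidealI[OF P])
    show "cring R" by (rule cring_axioms)
    show "carrier R \<noteq> P"
      using M.one_closed PM by blast
    fix a b assume a: "a \<in> carrier R" and b: "b \<in> carrier R" and ab: "a \<otimes> b \<in> P"
    show "a \<in> P \<or> b \<in> P"
    proof (rule ccontr)
      assume "\<not> ?thesis"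
      then obtain p r q r' where p: "p \<in> P" "r \<in> carrier R" "p \<oplus> r \<otimes> a \<in> M"
        and q: "q \<in> P" "r' \<in> carrier R" "q \<oplus> r' \<otimes> b \<in> M"
        using reach[OF a] reach[OF b] by blast
      have "(p \<oplus> r \<otimes> a) \<otimes> (q \<oplus> r' \<otimes> b) =
          p \<otimes> (q \<oplus> r' \<otimes> b) \<oplus> ((r \<otimes> a) \<otimes> q \<oplus> (r \<otimes> r') \<otimes> (a \<otimes> b))"
        using a b p q by (simp add: P.Icarr l_distr r_distr m_ac a_ac)
      also have "\<dots> \<in> P"
      proof (intro P.a_closed)
        show "p \<otimes> (q \<oplus> r' \<otimes> b) \<in> P"
          using b p q by (intro P.I_r_closed) (auto simp: P.Icarr)
        show "(r \<otimes> a) \<otimes> q \<in> P" "(r \<otimes> r') \<otimes> (a \<otimes> b) \<in> P"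
          using a p q ab by (auto intro: P.I_l_closed)
      qed
      finally show False
        using M.m_closed[OF p(3) q(3)] PM by blast
    qed
  qed
  then show ?thesis using that IP PM by blast
qed

text \<open>A prime ideal disjoint from \<open>S\<close> is its own colon ideal by every element of \<open>S\<close>, so it is
  \<open>S\<close>-prime with witness \<open>\<one>\<close>, and it belongs to \<open>V(E)\<close> only if it contains \<open>E\<close> itself.\<close>

lemma primeideal_in_Spec_S:
  assumes S: "mult_closed R S" and P: "primeideal P R" and disj: "P \<inter> S = {}"
  shows "P \<in> Spec_S R S"
proof -
  interpret P: primeideal P R by (rule P)
  have "\<one> \<in> S" using S by (simp add: mult_closed_def submonoid_def)
  moreover have "\<one> \<otimes> a \<in> P \<or> \<one> \<otimes> b \<in> P"
    if "a \<in> carrier R" "b \<in> carrier R" "a \<otimes> b \<in> P" for a b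
    using P.I_prime[OF that] that by simp
  ultimately show ?thesis
    using disj P.is_ideal unfolding Spec_S_def S_prime_def by blast
qed

lemma primeideal_in_V_S_iff:
  assumes S: "mult_closed R S" and P: "primeideal P R" and disj: "P \<inter> S = {}"
    and E: "E \<subseteq> carrier R"
  shows "P \<in> V_S R S E \<longleftrightarrow> E \<subseteq> P"
proof
  interpret P: primeideal P R by (rule P)
  assume "P \<in> V_S R S E"
  then obtain s where s: "s \<in> S" "\<And>e. e \<in> E \<Longrightarrow> s \<otimes> e \<in> P"
    by (auto simp: V_S_def)
  then show "E \<subseteq> P"
    using S E P.I_prime disj unfolding mult_closed_def submonoid_def by blast
next
  assume "E \<subseteq> P"
  moreover have "\<one> \<in> S" using S by (simp add: mult_closed_def submonoid_def)
  moreover have "\<one> \<otimes> e \<in> P" if "e \<in> E" for e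
    using subsetD[OF E that] subsetD[OF \<open>E \<subseteq> P\<close> that] by simp
  ultimately show "P \<in> V_S R S E"
    using primeideal_in_Spec_S[OF S P disj] unfolding V_S_def by blast
qed

section \<open>The sets \<open>V(f)\<close>\<close>

lemma V_S_antimono: "E \<subseteq> F \<Longrightarrow> V_S R S F \<subseteq> V_S R S E"
  unfolding V_S_def by blast

lemma V_S_singleton_eq_empty:
  assumes S: "mult_closed R S" and s: "s \<in> S"
  shows "V_S R S {s} = {}"
proof -
  have "t \<otimes> s \<in> S" if "t \<in> S" for t
    using that s S by (simp add: mult_closed_def submonoid_def)
  then show ?thesis
    by (auto simp: V_S_def Spec_S_def S_prime_def)
qed

lemma V_S_mult_subset:
  assumes S: "mult_closed R S" and a: "a \<in> carrier R" and b: "b \<in> carrier R"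
  shows "V_S R S {a \<otimes> b} \<subseteq> V_S R S {a} \<union> V_S R S {b}"
proof
  fix P assume P: "P \<in> V_S R S {a \<otimes> b}"
  then have PS: "P \<in> Spec_S R S" by (simp add: V_S_def)
  obtain s where s: "s \<in> S" "s \<otimes> (a \<otimes> b) \<in> P"
    using P by (auto simp: V_S_def)
  obtain t where t: "t \<in> S"
    and pr: "\<And>x y. x \<in> carrier R \<Longrightarrow> y \<in> carrier R \<Longrightarrow> x \<otimes> y \<in> P \<Longrightarrow> t \<otimes> x \<in> P \<or> t \<otimes> y \<in> P"
    using V_S_witness[OF S PS] by metis
  have carr: "s \<in> carrier R" "t \<in> carrier R" and ts: "t \<otimes> s \<in> S"
    using s t S by (auto simp: mult_closed_def submonoid_def)
  have "t \<otimes> (s \<otimes> a) \<in> P \<or> t \<otimes> b \<in> P"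
    using pr[of "s \<otimes> a" b] s(2) a b carr by (simp add: m_assoc)
  then have "(t \<otimes> s) \<otimes> a \<in> P \<or> t \<otimes> b \<in> P"
    using a carr by (simp add: m_assoc)
  then show "P \<in> V_S R S {a} \<union> V_S R S {b}"
    using ts t PS by (auto simp: V_S_def)
qed

lemma V_S_Int_subset_add:
  assumes S: "mult_closed R S" and a: "a \<in> carrier R" and b: "b \<in> carrier R"
  shows "V_S R S {a} \<inter> V_S R S {b} \<subseteq> V_S R S {a \<oplus> b}"
proof
  fix P assume P: "P \<in> V_S R S {a} \<inter> V_S R S {b}"
  then have PS: "P \<in> Spec_S R S" by (simp add: V_S_def)
  then interpret ideal P R by (simp add: Spec_S_def S_prime_def)
  \<comment> \<open>The witness from \<open>P\<close> serves for \<open>a\<close> and \<open>b\<close> at once.\<close>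
  obtain t where t: "t \<in> S"
    and w: "\<And>E. E \<subseteq> carrier R \<Longrightarrow> P \<in> V_S R S E \<longleftrightarrow> (\<forall>e\<in>E. t \<otimes> e \<in> P)"
    using V_S_witness[OF S PS] by metis
  have "t \<in> carrier R"
    using t S by (auto simp: mult_closed_def submonoid_def)
  then show "P \<in> V_S R S {a \<oplus> b}"
    using P a b w[of "{a}"] w[of "{b}"] w[of "{a \<oplus> b}"] by (simp add: r_distr)
qed

section \<open>Zariski clopen sets are flat open\<close>

text \<open>If \<open>V(I)\<close> and \<open>V(J)\<close> are disjoint, the sum of \<open>I\<close> and \<open>J\<close> reaches \<open>S\<close>, for otherwise a
  prime ideal between the sum and the complement of \<open>S\<close> would be a common point.\<close>

lemma disjoint_V_S_obtains_sum:
  assumes S: "mult_closed R S" and I: "ideal I R" and J: "ideal J R"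
    and disj: "V_S R S I \<inter> V_S R S J = {}"
  obtains a b where "a \<in> I" "b \<in> J" "a \<oplus> b \<in> S"
proof -
  have IJ: "I \<subseteq> carrier R" "J \<subseteq> carrier R"
    using I J by (auto dest: ideal.Icarr)
  have "(I <+>\<^bsub>R\<^esub> J) \<inter> S \<noteq> {}"
  proof
    assume "(I <+>\<^bsub>R\<^esub> J) \<inter> S = {}"
    moreover have "submonoid S R" using S by (simp add: mult_closed_def)
    ultimately obtain P where P: "primeideal P R" "I <+>\<^bsub>R\<^esub> J \<subseteq> P" "P \<inter> S = {}"
      using exists_primeideal_disjoint[OF add_ideals[OF I J]] by metis
    have "I \<union> J \<subseteq> I <+>\<^bsub>R\<^esub> J"
      using genideal_self[of "I \<union> J"] IJ union_genideal[OF I J] by simp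
    then have "I \<subseteq> P" "J \<subseteq> P" using P(2) by auto
    then have "P \<in> V_S R S I \<inter> V_S R S J"
      using primeideal_in_V_S_iff[OF S P(1,3)] IJ by simp
    then show False using disj by blast
  qed
  then show ?thesis
    using that by (auto simp: set_add_def')
qed

text \<open>A single generator is what makes the set open in the flat topology, since \<open>V(I)\<close> for an
  arbitrary ideal is only an intersection of possibly infinitely many sets \<open>V(f)\<close>.\<close>

lemma zariski_clopen_is_V_S_single:
  assumes S: "mult_closed R S"
    and U: "openin (S_zariski R S) U" "closedin (S_zariski R S) U"
  obtains a where "a \<in> carrier R" "U = V_S R S {a}"
proof -
  obtain I where I: "ideal I R" "U = V_S R S I"
    using U(2) closedin_S_zariski[OF S] by auto
  obtain J where J: "ideal J R" "U = Spec_S R S - V_S R S J"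
    using U(1) openin_S_zariski[OF S] by auto
  obtain a b where a: "a \<in> I" and b: "b \<in> J" and ab: "a \<oplus> b \<in> S"
    using disjoint_V_S_obtains_sum[OF S I(1) J(1)] I(2) J(2) by blast
  have carr: "a \<in> carrier R" "b \<in> carrier R"
    using a b I(1) J(1) by (auto dest: ideal.Icarr)
  have "V_S R S {a} \<inter> V_S R S {b} = {}"
    using V_S_Int_subset_add[OF S carr] V_S_singleton_eq_empty[OF S ab] by simp
  moreover have "V_S R S I \<subseteq> V_S R S {a}" "V_S R S J \<subseteq> V_S R S {b}"
    using a b by (auto intro!: V_S_antimono)
  moreover have "V_S R S {a} \<subseteq> Spec_S R S"
    by (auto simp: V_S_def)
  ultimately have "U = V_S R S {a}"
    using I(2) J(2) by blast
  then show ?thesis using that carr by blast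
qed

lemma zariski_clopen_imp_flat_open:
  assumes S: "mult_closed R S"
    and U: "openin (S_zariski R S) U" "closedin (S_zariski R S) U"
  shows "openin (S_flat R S) U"
proof -
  obtain a where "a \<in> carrier R" "U = V_S R S {a}"
    using zariski_clopen_is_V_S_single[OF assms] .
  then show ?thesis
    unfolding S_flat_def by (intro topology_generated_by_Basis) auto
qed

section \<open>Flat clopen sets are Zariski closed\<close>

text \<open>Let the sets \<open>V(f)\<close> with \<open>f \<in> A\<close> cover the spectrum. The elements \<open>m\<close> for which finitely many
  of them cover \<open>V(m)\<close> form a submonoid containing \<open>S\<close> and \<open>A\<close>. A prime ideal avoiding it would be
  a point outside the cover, so it contains \<open>\<zero>\<close>, and \<open>V(\<zero>)\<close> is everything.\<close>

lemma V_S_cover_finite_subcover: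
  assumes S: "mult_closed R S" and A: "A \<subseteq> carrier R"
    and cover: "Spec_S R S \<subseteq> (\<Union>f\<in>A. V_S R S {f})"
  obtains F where "finite F" "F \<subseteq> A" "Spec_S R S \<subseteq> (\<Union>f\<in>F. V_S R S {f})"
proof -
  define M where
    "M = {m \<in> carrier R. \<exists>F. finite F \<and> F \<subseteq> A \<and> V_S R S {m} \<subseteq> (\<Union>f\<in>F. V_S R S {f})}"
  have SM: "S \<subseteq> M"
  proof
    fix s assume s: "s \<in> S"
    then have "s \<in> carrier R" using S by (auto simp: mult_closed_def submonoid_def)
    then show "s \<in> M"
      by (auto simp: M_def V_S_singleton_eq_empty[OF S s] intro: exI[of _ "{}"])
  qed
  have AM: "A \<subseteq> M"
  proof
    fix f assume "f \<in> A"
    then show "f \<in> M"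
      using A by (auto simp: M_def intro!: exI[of _ "{f}"])
  qed
  have "submonoid M R"
  proof
    show "M \<subseteq> carrier R" by (auto simp: M_def)
    show "\<one> \<in> M" using S SM by (auto simp: mult_closed_def submonoid_def)
    fix m n assume "m \<in> M" "n \<in> M"
    then obtain F G where mn: "m \<in> carrier R" "n \<in> carrier R" and
      "finite F" "F \<subseteq> A" "V_S R S {m} \<subseteq> (\<Union>f\<in>F. V_S R S {f})"
      "finite G" "G \<subseteq> A" "V_S R S {n} \<subseteq> (\<Union>f\<in>G. V_S R S {f})"
      by (auto simp: M_def)
    then have "finite (F \<union> G) \<and> F \<union> G \<subseteq> A \<and> V_S R S {m \<otimes> n} \<subseteq> (\<Union>f\<in>F \<union> G. V_S R S {f})"
      using V_S_mult_subset[OF S mn] by blast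
    then show "m \<otimes> n \<in> M"
      using mn unfolding M_def by blast
  qed
  have "\<zero> \<in> M"
  proof (rule ccontr)
    assume "\<zero> \<notin> M"
    then obtain P where P: "primeideal P R" "P \<inter> M = {}"
      using exists_primeideal_disjoint[OF zeroideal \<open>submonoid M R\<close>] by auto
    then have PS: "P \<inter> S = {}" using SM by blast
    obtain f where "f \<in> A" "P \<in> V_S R S {f}"
      using cover primeideal_in_Spec_S[OF S P(1) PS] by blast
    then have "f \<in> P \<inter> M"
      using primeideal_in_V_S_iff[OF S P(1) PS, of "{f}"] A AM by auto
    then show False using P(2) by blast
  qed
  then show ?thesis
    using that by (auto simp: M_def V_S_zero[OF S])
qed

lemma compact_space_S_flat:
  assumes S: "mult_closed R S"
  shows "compact_space (S_flat R S)"
  unfolding S_flat_def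
proof (rule compact_space_topology_generated_by)
  let ?\<B> = "{V_S R S {f} |f. f \<in> carrier R}"
  fix \<C> assume \<C>: "\<C> \<subseteq> ?\<B>" and cover: "\<Union>\<C> = \<Union>?\<B>"
  have Spec: "\<Union>?\<B> = Spec_S R S"
    using topspace_S_flat[OF S] unfolding S_flat_def topology_generated_by_topspace .
  define A where "A = {f \<in> carrier R. V_S R S {f} \<in> \<C>}"
  have "\<C> = (\<lambda>f. V_S R S {f}) ` A"
    using \<C> by (auto simp: A_def)
  then have "Spec_S R S \<subseteq> (\<Union>f\<in>A. V_S R S {f})"
    using cover Spec by simp
  then obtain F where F: "finite F" "F \<subseteq> A" "Spec_S R S \<subseteq> (\<Union>f\<in>F. V_S R S {f})"
    using V_S_cover_finite_subcover[OF S, of A] by (auto simp: A_def)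
  have sub: "(\<lambda>f. V_S R S {f}) ` F \<subseteq> \<C>"
    using F(2) by (auto simp: A_def)
  have "(\<Union>f\<in>F. V_S R S {f}) = \<Union>?\<B>"
    using F(3) Union_mono[OF sub] unfolding cover Spec by (rule equalityI[rotated])
  then show "\<exists>\<C>'. finite \<C>' \<and> \<C>' \<subseteq> \<C> \<and> \<Union>\<C>' = \<Union>?\<B>"
    using F(1) sub by (intro exI[of _ "(\<lambda>f. V_S R S {f}) ` F"] conjI) simp_all
qed

lemma flat_clopen_imp_zariski_closed:
  assumes S: "mult_closed R S"
    and U: "openin (S_flat R S) U" "closedin (S_flat R S) U"
  shows "closedin (S_zariski R S) U"
proof -
  have "closedin (S_zariski R S) (V_S R S {f})" if "f \<in> carrier R" for f
    using that V_S_genideal[OF S, of "{f}"] genideal_ideal[of "{f}"]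
    by (auto simp: closedin_S_zariski[OF S])
  moreover have "compactin (S_flat R S) U"
    using closedin_compact_space[OF compact_space_S_flat[OF S] U(2)] .
  ultimately show ?thesis
    using U(1) unfolding S_flat_def
    by (elim compact_open_imp_closedin[rotated]) auto
qed

section \<open>Connectedness\<close>

lemma flat_clopen_iff_zariski_clopen:
  assumes S: "mult_closed R S"
  shows "openin (S_flat R S) U \<and> closedin (S_flat R S) U \<longleftrightarrow>
    openin (S_zariski R S) U \<and> closedin (S_zariski R S) U"
proof
  have compl: "openin X (topspace X - U) \<and> closedin X (topspace X - U)"
    if "openin X U \<and> closedin X U" for X :: "'a set topology"
    using that by (simp add: openin_diff closedin_diff)
  note top = topspace_S_flat[OF S] topspace_S_zariski[OF S]
  {
    assume U: "openin (S_flat R S) U \<and> closedin (S_flat R S) U"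
    have "closedin (S_zariski R S) (Spec_S R S - U)"
      using compl[OF U] flat_clopen_imp_zariski_closed[OF S] by (simp add: top)
    moreover have zU: "closedin (S_zariski R S) U"
      using U flat_clopen_imp_zariski_closed[OF S] by simp
    ultimately show "openin (S_zariski R S) U \<and> closedin (S_zariski R S) U"
      using closedin_subset[OF zU] by (simp add: openin_closedin_eq top)
  next
    assume U: "openin (S_zariski R S) U \<and> closedin (S_zariski R S) U"
    have "openin (S_flat R S) (Spec_S R S - U)"
      using compl[OF U] zariski_clopen_imp_flat_open[OF S] by (simp add: top)
    moreover have fU: "openin (S_flat R S) U"
      using U zariski_clopen_imp_flat_open[OF S] by simp
    ultimately show "openin (S_flat R S) U \<and> closedin (S_flat R S) U"
      using openin_subset[OF fU] by (simp add: closedin_def top)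
  }
qed

end

theorem corollary5p2:
  fixes R :: "('a, 'b) ring_scheme" and S :: "'a set"
  assumes "cring R"
    and "\<one>\<^bsub>R\<^esub> \<noteq> \<zero>\<^bsub>R\<^esub>"
    and "mult_closed R S"
  shows "connected_space (S_flat R S) \<longleftrightarrow> connected_space (S_zariski R S)"
proof -
  interpret cring R by (rule assms(1))
  show ?thesis
    unfolding connected_space_clopen_in flat_clopen_iff_zariski_clopen[OF assms(3)]
      topspace_S_flat[OF assms(3)] topspace_S_zariski[OF assms(3)] ..
qed

end
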